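(* There exists a zero-error randomized communication protocol (with public/shared randomness) in the two-party edge-partition model which, given an $n$-vertex graph $G$ and its maximum degree $\Delta$, finds a proper $(\Delta+1)$-coloring of $G$ using $O(n)$ bits of communication in expectation (for every input graph, the expectation being over the protocol's randomness).
   Context: Two-party edge-partition model: the input is an undirected graph $G=(V,E)$ on vertex set $V=[n]=\{1,\dots,n\}$ with maximum degree $\Delta$. The edge set $E$ is adversarially partitioned into two disjoint sets $E_A$ (given to Alice) and $E_B$ (given to Bob), $E=E_A\cup E_B$, $E_A\cap E_B=\emptyset$. Both players know $n$ and $\Delta$ and have access to shared public randomness. The players exchange bits; the cost is the number of bits communicated. At the end both players must agree on a color for every vertex. A $q$-coloring is a vector $C\in[q]^n$; it is proper if $C(u)\neq C(v)$ for every edge $\{u,v\}\in E$. Zero-error means the output is always a proper coloring. *)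

theory Defs
  imports "HOL-Probability.Probability"
begin

text \<open>An undirected edge is a two-element set of vertices; no loops, no parallel edges.\<close>

type_synonym edges = "nat set set"

definition graph_on :: "nat \<Rightarrow> edges \<Rightarrow> bool" where
  "graph_on n E \<longleftrightarrow> (\<forall>e\<in>E. e \<subseteq> {1..n} \<and> card e = 2)"

definition degree :: "edges \<Rightarrow> nat \<Rightarrow> nat" where
  "degree E v = card {e \<in> E. v \<in> e}"

text \<open>Only meaningful for \<open>n \<ge> 1\<close>, since \<open>Max {}\<close> is unspecified.\<close>

definition max_degree :: "nat \<Rightarrow> edges \<Rightarrow> nat" where
  "max_degree n E = Max (degree E ` {1..n})"

definition colorings :: "nat \<Rightarrow> nat \<Rightarrow> (nat \<Rightarrow> nat) set" where
  "colorings n q = {1..n} \<rightarrow>\<^sub>E {1..q}"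

definition proper_coloring :: "nat \<Rightarrow> nat \<Rightarrow> edges \<Rightarrow> (nat \<Rightarrow> nat) \<Rightarrow> bool" where
  "proper_coloring n q E C \<longleftrightarrow>
     C \<in> colorings n q \<and> (\<forall>u v. {u, v} \<in> E \<longrightarrow> C u \<noteq> C v)"

text \<open>
  A deterministic protocol is a binary tree. At an inner node its owner sends one bit, computed
  from the owner's private input and (through the position in the tree) from the bits exchanged
  so far; the walk continues in the subtree selected by that bit. The output sits at the leaf, so
  it is determined by the transcript and both players know it.
\<close>

datatype ('a, 'b, 'o) protocol =
    Output 'o
  | Alice "'a \<Rightarrow> bool" "bool \<Rightarrow> ('a, 'b, 'o) protocol"
  | Bob "'b \<Rightarrow> bool" "bool \<Rightarrow> ('a, 'b, 'o) protocol"

primrec run :: "('a, 'b, 'o) protocol \<Rightarrow> 'a \<Rightarrow> 'b \<Rightarrow> 'o" where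
  "run (Output z) x y = z"
| "run (Alice f T) x y = run (T (f x)) x y"
| "run (Bob g T) x y = run (T (g y)) x y"

primrec bits :: "('a, 'b, 'o) protocol \<Rightarrow> 'a \<Rightarrow> 'b \<Rightarrow> nat" where
  "bits (Output z) x y = 0"
| "bits (Alice f T) x y = Suc (bits (T (f x)) x y)"
| "bits (Bob g T) x y = Suc (bits (T (g y)) x y)"

text \<open>
  A public-coin protocol is a probability distribution over deterministic protocols: the shared
  randomness, drawn independently of the inputs, selects the tree that both players follow.
\<close>

type_synonym ('a, 'b, 'o) public_coin_protocol = "('a, 'b, 'o) protocol pmf"

text \<open>
  The expectation is a nonnegative integral, with value \<open>\<infinity>\<close> if it diverges; the Bochner
  expectation would be \<open>0\<close> in that case.
\<close>

definition expected_bits :: "('a, 'b, 'o) public_coin_protocol \<Rightarrow> 'a \<Rightarrow> 'b \<Rightarrow> ennreal" where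
  "expected_bits P x y = (\<integral>\<^sup>+ T. of_nat (bits T x y) \<partial>measure_pmf P)"

definition edge_partition_input :: "nat \<Rightarrow> nat \<Rightarrow> edges \<Rightarrow> edges \<Rightarrow> bool" where
  "edge_partition_input n \<Delta> EA EB \<longleftrightarrow>
     EA \<inter> EB = {} \<and> graph_on n (EA \<union> EB) \<and> max_degree n (EA \<union> EB) = \<Delta>"

definition zero_error_coloring ::
    "nat \<Rightarrow> nat \<Rightarrow> nat \<Rightarrow> (edges, edges, nat \<Rightarrow> nat) public_coin_protocol \<Rightarrow> bool" where
  "zero_error_coloring n \<Delta> q P \<longleftrightarrow>
     (\<forall>EA EB. edge_partition_input n \<Delta> EA EB \<longrightarrow>
        (\<forall>T \<in> set_pmf P. proper_coloring n q (EA \<union> EB) (run T EA EB)))"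

end

theory Submission
  imports Defs
begin

text \<open>
  Colour the vertices greedily in a uniformly random order. Suppose that \<open>j\<close> neighbours of \<open>v\<close> are
  already coloured, and write \<open>q = \<Delta> + 1\<close> and \<open>\<mu> = (q - j) / q\<close>. The colour sets \<open>A\<close> and \<open>B\<close> blocked
  for \<open>v\<close> on Alice's and on Bob's side satisfy \<open>|A| + |B| \<le> (1 - \<mu>) q\<close>, so in a public random sample
  of about \<open>\<mu>\<^sup>-\<^sup>2\<close> colours the hits of \<open>A\<close> and of \<open>B\<close> together are likely to be fewer than the sample
  size. Then a binary search in which both players announce their counts finds a free colour with
  polylogarithmically many bits in the sample size. As \<open>\<mu>\<close> is not known to both players, samples of
  size \<open>16 ^ i\<close> are tried for \<open>i = 0, 1, ...\<close>, with the full palette in the end; the expected cost is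
  \<open>O(1 / sqrt \<mu>)\<close>. In a random order \<open>j\<close> is uniform on \<open>{0..deg v}\<close>, and the average of
  \<open>sqrt (q / (q - j))\<close> is at most 2, so each vertex costs \<open>O(1)\<close> bits in expectation.
\<close>

section \<open>Composing protocols\<close>

primrec bindp :: "('a, 'b, 'o) protocol \<Rightarrow> ('o \<Rightarrow> ('a, 'b, 'p) protocol) \<Rightarrow> ('a, 'b, 'p) protocol" where
  "bindp (Output z) K = K z"
| "bindp (Alice f T) K = Alice f (\<lambda>b. bindp (T b) K)"
| "bindp (Bob g T) K = Bob g (\<lambda>b. bindp (T b) K)"

lemma run_bindp [simp]: "run (bindp T K) x y = run (K (run T x y)) x y"
  by (induction T) auto

lemma bits_bindp [simp]: "bits (bindp T K) x y = bits T x y + bits (K (run T x y)) x y"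
  by (induction T) auto

text \<open>The width \<open>k\<close> is fixed, so the cost does not depend on the input. The low
  bit goes first; larger values arrive modulo \<open>2 ^ k\<close>.\<close>

primrec alice_send :: "nat \<Rightarrow> ('a \<Rightarrow> nat) \<Rightarrow> ('a, 'b, nat) protocol" where
  "alice_send 0 f = Output 0"
| "alice_send (Suc k) f = Alice (\<lambda>x. odd (f x))
     (\<lambda>b. bindp (alice_send k (\<lambda>x. f x div 2)) (\<lambda>r. Output (2 * r + of_bool b)))"

primrec bob_send :: "nat \<Rightarrow> ('b \<Rightarrow> nat) \<Rightarrow> ('a, 'b, nat) protocol" where
  "bob_send 0 g = Output 0"
| "bob_send (Suc k) g = Bob (\<lambda>y. odd (g y))
     (\<lambda>b. bindp (bob_send k (\<lambda>y. g y div 2)) (\<lambda>r. Output (2 * r + of_bool b)))"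

lemma run_alice_send: "f x < 2 ^ k \<Longrightarrow> run (alice_send k f) x y = f x"
  by (induction k arbitrary: f) (auto simp: of_bool_def)

lemma run_bob_send: "g y < 2 ^ k \<Longrightarrow> run (bob_send k g) x y = g y"
  by (induction k arbitrary: g) (auto simp: of_bool_def)

lemma bits_alice_send [simp]: "bits (alice_send k f) x y = k"
  by (induction k arbitrary: f) auto

lemma bits_bob_send [simp]: "bits (bob_send k g) x y = k"
  by (induction k arbitrary: g) auto

section \<open>Finding an element outside two sets\<close>

definition hits :: "'c set \<Rightarrow> 'c list \<Rightarrow> nat" where
  "hits S xs = length (filter (\<lambda>c. c \<in> S) xs)"

lemma hits_Nil [simp]: "hits S [] = 0"
  by (simp add: hits_def)

lemma hits_Cons [simp]: "hits S (c # xs) = of_bool (c \<in> S) + hits S xs"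
  by (simp add: hits_def)

lemma hits_append [simp]: "hits S (xs @ ys) = hits S xs + hits S ys"
  by (simp add: hits_def)

lemma hits_le_length: "hits S xs \<le> length xs"
  by (simp add: hits_def)

lemma hits_distinct: "distinct xs \<Longrightarrow> finite S \<Longrightarrow> hits S xs \<le> card S"
  unfolding hits_def
  by (metis (no_types, lifting) card_mono distinct_card distinct_filter mem_Collect_eq set_filter subsetI)

primrec search :: "('a \<Rightarrow> 'c set) \<Rightarrow> ('b \<Rightarrow> 'c set) \<Rightarrow> nat \<Rightarrow> 'c list \<Rightarrow> ('a, 'b, 'c) protocol" where
  "search A B 0 xs = Output (hd xs)"
| "search A B (Suc j) xs =
     bindp (alice_send (Suc j) (\<lambda>x. hits (A x) (take (2 ^ j) xs))) (\<lambda>a.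
     bindp (bob_send (Suc j) (\<lambda>y. hits (B y) (take (2 ^ j) xs))) (\<lambda>b.
     search A B j (if a + b < length (take (2 ^ j) xs) then take (2 ^ j) xs else drop (2 ^ j) xs)))"

lemma bits_search: "bits (search A B j xs) x y = j * (j + 1)"
  by (induction j arbitrary: xs) auto

text \<open>Halving keeps the invariant that the two sets, counted with multiplicity, cannot cover the
  list, so one element outside both sets survives.\<close>

lemma run_search:
  assumes "hits (A x) xs + hits (B y) xs < length xs" "length xs \<le> 2 ^ j"
  shows "run (search A B j xs) x y \<in> set xs - (A x \<union> B y)"
  using assms
proof (induction j arbitrary: xs)
  case 0
  then show ?case
    by (cases xs) (auto simp: of_bool_def split: if_splits)
next
  case (Suc j)
  define l r where "l = take (2 ^ j) xs" and "r = drop (2 ^ j) xs"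
  have xs: "xs = l @ r"
    by (simp add: l_def r_def)
  have len: "length l \<le> 2 ^ j" "length r \<le> 2 ^ j"
    using Suc.prems by (auto simp: l_def r_def)
  \<comment> \<open>All \<open>2 ^ j\<close> places of a half can be hits, a count that takes
    \<open>j + 1\<close> bits.\<close>
  have small: "hits S l < 2 ^ Suc j" for S
    using hits_le_length[of S l] len by (simp add: order.strict_trans1)
  have a: "run (alice_send (Suc j) (\<lambda>x. hits (A x) l)) x y = hits (A x) l"
    by (intro run_alice_send small)
  have b: "run (bob_send (Suc j) (\<lambda>y. hits (B y) l)) x y = hits (B y) l"
    by (intro run_bob_send small)
  have step: "run (search A B (Suc j) xs) x y =
      run (search A B j (if hits (A x) l + hits (B y) l < length l then l else r)) x y"
    by (simp only: search.simps run_bindp flip: l_def r_def) (simp only: a b)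
  show ?case
  proof (cases "hits (A x) l + hits (B y) l < length l")
    case True
    then show ?thesis
      using Suc.IH[of l] len step xs by auto
  next
    case False
    then have "hits (A x) r + hits (B y) r < length r"
      using Suc.prems xs by simp
    then show ?thesis
      using Suc.IH[of r] len step xs False by auto
  qed
qed

text \<open>\<open>4 * i\<close> halvings exhaust a list of \<open>16 ^ i\<close> entries. On a
  covered list the search result is arbitrary, so the players verify it with two further bits;
  testing membership in the public list \<open>xs\<close> is free.\<close>

primrec trial ::
    "('a \<Rightarrow> nat set) \<Rightarrow> ('b \<Rightarrow> nat set) \<Rightarrow> nat \<Rightarrow> nat list list \<Rightarrow> ('a, 'b, nat) protocol" where
  "trial A B i [] = Output 0"
| "trial A B i (xs # xss) = bindp (search A B (4 * i) xs) (\<lambda>c.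
     Alice (\<lambda>x. c \<in> A x) (\<lambda>p. Bob (\<lambda>y. c \<in> B y) (\<lambda>r.
       if p \<or> r \<or> c \<notin> set xs then trial A B (Suc i) xss else Output c)))"

text \<open>Elements of both sets count twice, so a covered list may still contain a free element.
  The event is chosen because the players can detect its negation from two counts.\<close>

definition covered :: "'c set \<Rightarrow> 'c set \<Rightarrow> 'c list set" where
  "covered S T = {xs. length xs \<le> hits S xs + hits T xs}"

text \<open>An uncovered sample makes the search succeed, so the later stages are paid for only on
  the event \<open>covered\<close>.\<close>

lemma bits_trial:
  assumes "length xs \<le> 16 ^ i"
  shows "bits (trial A B i (xs # xss)) x y \<le>
    4 * i * (4 * i + 1) + 2 + indicator (covered (A x) (B y)) xs * bits (trial A B (Suc i) xss) x y"
proof -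
  have "run (search A B (4 * i) xs) x y \<in> set xs - (A x \<union> B y)" if "xs \<notin> covered (A x) (B y)"
    using that assms by (intro run_search) (auto simp: covered_def power_mult)
  then show ?thesis
    by (auto simp: bits_search indicator_def)
qed

text \<open>Zero error: a candidate is verified before it is output, so no luck with the earlier
  lists is needed once the last one is uncovered.\<close>

lemma run_trial:
  assumes "xss \<noteq> []" "last xss \<notin> covered (A x) (B y)" "length (last xss) \<le> 16 ^ (i + length xss - 1)"
  shows "run (trial A B i xss) x y \<in> \<Union> (set ` set xss) - (A x \<union> B y)"
  using assms
proof (induction xss arbitrary: i)
  case (Cons xs xss)
  show ?case
  proof (cases "xss = []")
    case True
    then have "run (search A B (4 * i) xs) x y \<in> set xs - (A x \<union> B y)"
      using Cons.prems by (intro run_search) (auto simp: covered_def power_mult)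
    then show ?thesis
      by auto
  next
    case False
    then have "run (trial A B (Suc i) xss) x y \<in> \<Union> (set ` set xss) - (A x \<union> B y)"
      using Cons.prems by (intro Cons.IH) auto
    then show ?thesis
      by auto
  qed
qed simp

section \<open>The expected cost of finding a free colour\<close>

lemma nn_integral_prod_list_replicate_pmf:
  fixes f :: "'c \<Rightarrow> ennreal"
  shows "(\<integral>\<^sup>+ xs. prod_list (map f xs) \<partial>replicate_pmf n p) = (\<integral>\<^sup>+ x. f x \<partial>p) ^ n"
  by (induction n) (simp_all add: nn_integral_cmult nn_integral_multc)

text \<open>A Chernoff bound with the exponential moment of base \<open>1 + \<mu>/2\<close>.\<close>

lemma emeasure_covered:
  assumes "finite S" "finite T" "q > 0" "0 \<le> \<mu>" "\<mu> \<le> 1"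
    and card: "real (card S + card T) \<le> (1 - \<mu>) * real q"
  shows "emeasure (replicate_pmf s (pmf_of_set {1..q})) (covered S T) \<le> ennreal ((1 - \<mu>\<^sup>2 / 6) ^ s)"
proof -
  define t where "t = \<mu> / 2"
  \<comment> \<open>Dividing by \<open>1 + t\<close> per draw makes the product of the weights at
    least 1 on every covered list, as Markov's inequality requires.\<close>
  define w where "w c = (1 + t) ^ (of_bool (c \<in> S) + of_bool (c \<in> T)) / (1 + t)" for c
  have t: "t \<ge> 0"
    using assms by (simp add: t_def)
  have w0: "w c \<ge> 0" for c
    using t by (simp add: w_def)
  have prod_w: "prod_list (map w xs) = (1 + t) ^ (hits S xs + hits T xs) / (1 + t) ^ length xs" for xs
    by (induction xs) (simp_all add: w_def power_add)
  have prod_ennreal: "prod_list (map (\<lambda>c. ennreal (w c)) xs) = ennreal (prod_list (map w xs))" for xs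
    proof (induction xs)
    case (Cons c xs)
    have "0 \<le> prod_list (map w xs)"
      using w0 by (intro prod_list_nonneg) auto
    then show ?case
      using Cons w0 by (simp add: ennreal_mult)
  qed simp
  have le: "indicator (covered S T) xs \<le> prod_list (map (\<lambda>c. ennreal (w c)) xs)" for xs
    unfolding prod_ennreal prod_w using t
    by (auto simp: covered_def indicator_def intro!: power_increasing)
  \<comment> \<open>The term \<open>t\<^sup>2\<close> is needed for a colour in both sets, where
    equality holds.\<close>
  have w_le: "(1 + t) * w c \<le> 1 + t * indicator S c + t * indicator T c + t\<^sup>2" for c
    using t by (auto simp: w_def indicator_def power2_eq_square field_simps)
  have sum_ind: "(\<Sum>c=1..q. indicator X c) \<le> real (card X)" if "finite X" for X :: "nat set"
  proof -
    have "(\<Sum>c=1..q. indicator X c) = (\<Sum>c\<in>{1..q} \<inter> X. 1 :: real)"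
      by (subst sum.inter_restrict) (auto simp: indicator_def of_bool_def)
    then show ?thesis
      using that by (simp add: card_mono)
  qed
  have "(1 + t) * (\<Sum>c=1..q. w c) \<le> (\<Sum>c=1..q. 1 + t * indicator S c + t * indicator T c + t\<^sup>2)"
    unfolding sum_distrib_left by (intro sum_mono w_le)
  also have "\<dots> = real q + t * (\<Sum>c=1..q. indicator S c) + t * (\<Sum>c=1..q. indicator T c) + real q * t\<^sup>2"
    by (simp add: sum.distrib sum_distrib_left)
  also have "\<dots> \<le> real q + t * real (card S) + t * real (card T) + real q * t\<^sup>2"
    using sum_ind assms t by (intro add_mono mult_left_mono) auto
  also have "\<dots> = real q + t * real (card S + card T) + real q * t\<^sup>2"
    by (simp add: algebra_simps)
  also have "\<dots> \<le> real q + t * ((1 - \<mu>) * real q) + real q * t\<^sup>2"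
    using card t by (intro add_mono mult_left_mono) auto
  also have "\<dots> = real q * (1 + \<mu> / 2 - \<mu>\<^sup>2 / 4)"
    by (simp add: t_def algebra_simps power2_eq_square)
  also have "\<dots> \<le> real q * ((1 + t) * (1 - \<mu>\<^sup>2 / 6))"
  proof (intro mult_left_mono)
    \<comment> \<open>After expansion the claim reduces to this inequality divided by 12; the
      constant \<open>1 / 6\<close> is attained at \<open>\<mu> = 1\<close>.\<close>
    have "\<mu>\<^sup>2 * \<mu> \<le> \<mu>\<^sup>2 * 1"
      using assms by (intro mult_left_mono) auto
    then show "1 + \<mu> / 2 - \<mu>\<^sup>2 / 4 \<le> (1 + t) * (1 - \<mu>\<^sup>2 / 6)"
      by (simp add: t_def algebra_simps)
  qed simp
  finally have "(1 + t) * (\<Sum>c=1..q. w c) \<le> (1 + t) * (real q * (1 - \<mu>\<^sup>2 / 6))"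
    by (simp add: mult_ac)
  then have "(\<Sum>c=1..q. w c) \<le> real q * (1 - \<mu>\<^sup>2 / 6)"
    by (rule mult_left_le_imp_le) (use t in simp)
  then have mean: "(\<Sum>c=1..q. w c) / real q \<le> 1 - \<mu>\<^sup>2 / 6"
    using assms by (simp add: field_simps)
  have "(\<integral>\<^sup>+ c. ennreal (w c) \<partial>pmf_of_set {1..q}) = (\<Sum>c=1..q. ennreal (w c)) / ennreal (real q)"
    using assms by (simp add: nn_integral_pmf_of_set ennreal_of_nat_eq_real_of_nat)
  also have "\<dots> = ennreal ((\<Sum>c=1..q. w c) / real q)"
    using assms w0 by (simp add: sum_ennreal divide_ennreal sum_nonneg)
  also have "\<dots> \<le> ennreal (1 - \<mu>\<^sup>2 / 6)"
    using mean by (rule ennreal_leI)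
  finally have int: "(\<integral>\<^sup>+ c. ennreal (w c) \<partial>pmf_of_set {1..q}) \<le> ennreal (1 - \<mu>\<^sup>2 / 6)" .
  have "emeasure (replicate_pmf s (pmf_of_set {1..q})) (covered S T) =
      (\<integral>\<^sup>+ xs. indicator (covered S T) xs \<partial>replicate_pmf s (pmf_of_set {1..q}))"
    by simp
  also have "\<dots> \<le> (\<integral>\<^sup>+ xs. prod_list (map (\<lambda>c. ennreal (w c)) xs) \<partial>replicate_pmf s (pmf_of_set {1..q}))"
    by (intro nn_integral_mono le)
  also have "\<dots> \<le> ennreal (1 - \<mu>\<^sup>2 / 6) ^ s"
    unfolding nn_integral_prod_list_replicate_pmf using int by (rule power_mono) simp
  also have "\<dots> = ennreal ((1 - \<mu>\<^sup>2 / 6) ^ s)"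
    using assms power_le_one[of \<mu> 2] by (intro ennreal_power) simp
  finally show ?thesis .
qed

text \<open>The cap at 1 allows the factors of earlier failures to be dropped; the decay
  \<open>1 / 2 ^ i\<close> beats the quadratic cost of a stage.\<close>

definition fail_bound :: "real \<Rightarrow> nat \<Rightarrow> real" where
  "fail_bound \<mu> i = min 1 (2 / (2 ^ i * sqrt \<mu>))"

text \<open>The fourth root of the Chernoff bound suffices, and makes the cost proportional to
  \<open>1 / sqrt \<mu>\<close>, which is summable over the slack.\<close>

lemma power_le_fail_bound:
  assumes "0 < \<mu>" "\<mu> \<le> 1"
  shows "(1 - \<mu>\<^sup>2 / 6) ^ (16 ^ i) \<le> fail_bound \<mu> i"
proof -
  define p u where "p = (1 - \<mu>\<^sup>2 / 6) ^ (16 ^ i)" and "u = 1 / (2 ^ i * sqrt \<mu>)"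
  have \<mu>2: "0 < \<mu>\<^sup>2" "\<mu>\<^sup>2 \<le> 1"
    using assms by (auto simp: power_le_one)
  have p: "0 \<le> p" "p \<le> 1"
    using \<mu>2 by (auto simp: p_def power_le_one)
  have u: "u > 0"
    using assms by (simp add: u_def)
  \<comment> \<open>With \<open>x = \<mu>\<^sup>2 / 6\<close> and \<open>N = 16 ^ i\<close>,
    Bernoulli gives \<open>(1 + x) ^ N \<ge> 1 + N * x\<close>, while
    \<open>(1 - x) ^ N * (1 + x) ^ N \<le> 1\<close>. Hence \<open>p\<close> is at most
    \<open>1 / (N * x)\<close>.\<close>
  have "p * (1 + real (16 ^ i) * (\<mu>\<^sup>2 / 6)) \<le> p * (1 + \<mu>\<^sup>2 / 6) ^ (16 ^ i)"
    using \<mu>2 p by (intro mult_left_mono Bernoulli_inequality) linarith+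
  also have "\<dots> = (1 - (\<mu>\<^sup>2 / 6)\<^sup>2) ^ (16 ^ i)"
    by (simp add: p_def flip: power_mult_distrib) (simp add: algebra_simps power2_eq_square)
  also have "\<dots> \<le> 1"
    using \<mu>2 by (intro power_le_one) (auto intro!: power_le_one)
  finally have "p * (16 ^ i * (\<mu>\<^sup>2 / 6)) \<le> 1"
    using p by (simp add: distrib_left)
  then have "p \<le> 6 / (16 ^ i * \<mu>\<^sup>2)"
    using \<mu>2 by (simp add: field_simps)
  moreover have "u ^ 4 = 1 / (16 ^ i * \<mu>\<^sup>2)"
  proof -
    have "sqrt \<mu> ^ 4 = \<mu>\<^sup>2"
      using assms by (simp add: power4_eq_xxxx power2_eq_square)
    moreover have "((2::real) ^ i) ^ 4 = 16 ^ i"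
      by (induction i) (auto simp: power_mult_distrib)
    ultimately show ?thesis
      by (simp add: u_def power_divide power_mult_distrib)
  qed
  ultimately have "p \<le> 6 * u ^ 4"
    by simp
  \<comment> \<open>Since \<open>p \<le> 1\<close>, only \<open>2 * u < 1\<close> matters; then
    \<open>u ^ 3 \<le> 1 / 8\<close> reduces the fourth power to a linear bound.\<close>
  have "p \<le> 2 * u"
  proof (rule ccontr)
    assume "\<not> p \<le> 2 * u"
    then have "2 * u \<le> 1"
      using p by simp
    then have "(2 * u) ^ 3 \<le> 1"
      using u by (intro power_le_one) auto
    then have "u * (8 * u ^ 3) \<le> u * 1"
      using u by (intro mult_left_mono) (auto simp: power_mult_distrib)
    then have "8 * u ^ 4 \<le> u"
      by (simp add: power4_eq_xxxx power3_eq_cube mult_ac)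
    then show False
      using \<open>p \<le> 6 * u ^ 4\<close> \<open>\<not> p \<le> 2 * u\<close> u by linarith
  qed
  then show ?thesis
    using p by (simp add: fail_bound_def p_def u_def)
qed

text \<open>After \<open>r\<close> random stages comes the full palette, which is uncovered whenever
  fewer than \<open>q\<close> colours are blocked. The growth factor 16 makes the fourth root of the
  failure bound halve at each stage.\<close>

primrec samples :: "nat \<Rightarrow> nat \<Rightarrow> nat \<Rightarrow> nat list list pmf" where
  "samples q i 0 = return_pmf [[1..<Suc q]]"
| "samples q i (Suc r) = do {
     xs \<leftarrow> replicate_pmf (16 ^ i) (pmf_of_set {1..q});
     xss \<leftarrow> samples q (Suc i) r;
     return_pmf (xs # xss)}"

lemma samplesD:
  assumes "xss \<in> set_pmf (samples q i r)" "q > 0"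
  shows "xss \<noteq> [] \<and> last xss = [1..<Suc q] \<and> length xss = Suc r \<and> \<Union> (set ` set xss) \<subseteq> {1..q}"
  using assms(1)
proof (induction r arbitrary: i xss)
  case 0
  then show ?case
    by (auto simp del: upt_Suc)
next
  case (Suc r)
  then obtain xs yss where xs: "xs \<in> set_pmf (replicate_pmf (16 ^ i) (pmf_of_set {1..q}))"
      and yss: "yss \<in> set_pmf (samples q (Suc i) r)" and "xss = xs # yss"
    by (auto simp del: upt_Suc)
  moreover have "set xs \<subseteq> {1..q}"
    using xs \<open>q > 0\<close> by (auto simp: set_replicate_pmf lists_eq_set)
  ultimately show ?case
    using Suc.IH[OF yss] by simp
qed

text \<open>The search bits and the two verification bits, \<open>4 * i * (4 * i + 1) + 2\<close>,
  multiplied out.\<close>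

definition stage_cost :: "nat \<Rightarrow> real" where
  "stage_cost i = 16 * (real i)\<^sup>2 + 4 * real i + 2"

text \<open>Stage \<open>j + 1\<close> is entered only if stage \<open>j\<close> fails, which
  explains the shift to \<open>Suc j\<close> in the sum; later samples are independent of that
  failure. The chance of surviving the stages before \<open>j\<close> is bounded by 1. The bound on
  \<open>q\<close> makes the palette fit the last search.\<close>

lemma expected_bits_trial:
  assumes "finite (A x)" "finite (B y)" "q > 0" "0 < \<mu>" "\<mu> \<le> 1" "q \<le> 16 ^ (i + r)"
    and card: "real (card (A x) + card (B y)) \<le> (1 - \<mu>) * real q"
  shows "(\<integral>\<^sup>+ xss. of_nat (bits (trial A B i xss) x y) \<partial>samples q i r) \<le>
    ennreal (stage_cost i + (\<Sum>j=i..<i+r. fail_bound \<mu> j * stage_cost (Suc j)))"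
  using \<open>q \<le> 16 ^ (i + r)\<close>
proof (induction r arbitrary: i)
  case 0
  have "[1..<Suc q] \<notin> covered (A x) (B y)"
  proof -
    have "real (card (A x) + card (B y)) < real q"
      using card assms by (smt (verit) mult_le_cancel_right1 of_nat_0_less_iff mult_less_cancel_right_disj)
    then show ?thesis
      using hits_distinct[of "[1..<Suc q]" "A x"] hits_distinct[of "[1..<Suc q]" "B y"] assms
      by (simp add: covered_def del: upt_Suc)
  qed
  then have "bits (trial A B i [[1..<Suc q]]) x y \<le> 4 * i * (4 * i + 1) + 2"
    using bits_trial[of "[1..<Suc q]" i A B "[]" x y] 0 by (simp del: upt_Suc)
  then have "real (bits (trial A B i [[1..<Suc q]]) x y) \<le> real (4 * i * (4 * i + 1) + 2)"
    by (simp only: of_nat_le_iff)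
  also have "\<dots> = stage_cost i"
    by (simp add: stage_cost_def power2_eq_square algebra_simps)
  finally show ?case
    by (simp add: ennreal_of_nat_eq_real_of_nat ennreal_leI del: upt_Suc trial.simps)
next
  case (Suc r)
  define R where "R = (\<Sum>j=Suc i..<Suc i+r. fail_bound \<mu> j * stage_cost (Suc j))"
  define N where "N xss = (of_nat (bits (trial A B (Suc i) xss) x y) :: ennreal)" for xss
  have fb: "0 \<le> fail_bound \<mu> j" "fail_bound \<mu> j \<le> 1" for j
    using assms by (auto simp: fail_bound_def)
  have sc: "0 \<le> stage_cost j" for j
    by (simp add: stage_cost_def)
  have R: "0 \<le> R"
    unfolding R_def by (intro sum_nonneg mult_nonneg_nonneg fb sc)
  have IH: "(\<integral>\<^sup>+ xss. N xss \<partial>samples q (Suc i) r) \<le> ennreal (stage_cost (Suc i) + R)"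
    unfolding N_def R_def using Suc by (intro Suc.IH) simp
  have step: "(of_nat (bits (trial A B i (xs # xss)) x y) :: ennreal) \<le>
      ennreal (stage_cost i) + indicator (covered (A x) (B y)) xs * N xss"
    if "xs \<in> set_pmf (replicate_pmf (16 ^ i) (pmf_of_set {1..q}))" for xs xss
  proof -
    have "length xs \<le> 16 ^ i"
      using that by (simp add: set_replicate_pmf)
    from bits_trial[OF this, of A B xss x y]
    have "(of_nat (bits (trial A B i (xs # xss)) x y) :: ennreal) \<le>
      of_nat (4 * i * (4 * i + 1) + 2 +
        indicator (covered (A x) (B y)) xs * bits (trial A B (Suc i) xss) x y)"
      by (simp only: of_nat_le_iff)
    also have "\<dots> = of_nat (4 * i * (4 * i + 1) + 2) + indicator (covered (A x) (B y)) xs * N xss"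
      by (simp add: N_def indicator_def)
    also have "of_nat (4 * i * (4 * i + 1) + 2) = ennreal (stage_cost i)"
      unfolding ennreal_of_nat_eq_real_of_nat
      by (rule arg_cong[of _ _ ennreal]) (simp add: stage_cost_def power2_eq_square algebra_simps)
    finally show ?thesis .
  qed
  have "(\<integral>\<^sup>+ xss. of_nat (bits (trial A B i xss) x y) \<partial>samples q i (Suc r)) =
      (\<integral>\<^sup>+ xs. \<integral>\<^sup>+ xss. of_nat (bits (trial A B i (xs # xss)) x y) \<partial>samples q (Suc i) r
        \<partial>replicate_pmf (16 ^ i) (pmf_of_set {1..q}))"
    by (simp del: trial.simps)
  also have "\<dots> \<le> (\<integral>\<^sup>+ xs. \<integral>\<^sup>+ xss. ennreal (stage_cost i) + indicator (covered (A x) (B y)) xs * N xss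
      \<partial>samples q (Suc i) r \<partial>replicate_pmf (16 ^ i) (pmf_of_set {1..q}))"
    by (intro nn_integral_mono_AE AE_pmfI nn_integral_mono step)
  also have "\<dots> = ennreal (stage_cost i) +
      emeasure (replicate_pmf (16 ^ i) (pmf_of_set {1..q})) (covered (A x) (B y)) *
      (\<integral>\<^sup>+ xss. N xss \<partial>samples q (Suc i) r)"
    by (simp add: nn_integral_add nn_integral_cmult nn_integral_multc)
  also have "\<dots> \<le> ennreal (stage_cost i) + ennreal (fail_bound \<mu> i) * ennreal (stage_cost (Suc i) + R)"
  proof (intro add_left_mono mult_mono IH)
    have "emeasure (replicate_pmf (16 ^ i) (pmf_of_set {1..q})) (covered (A x) (B y)) \<le>
        ennreal ((1 - \<mu>\<^sup>2 / 6) ^ (16 ^ i))"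
      using assms by (intro emeasure_covered) auto
    also have "\<dots> \<le> ennreal (fail_bound \<mu> i)"
      using assms by (intro ennreal_leI power_le_fail_bound)
    finally show "emeasure (replicate_pmf (16 ^ i) (pmf_of_set {1..q})) (covered (A x) (B y)) \<le> \<dots>" .
  qed auto
  also have "\<dots> = ennreal (stage_cost i + fail_bound \<mu> i * (stage_cost (Suc i) + R))"
    using fb sc R by (simp add: ennreal_mult ennreal_plus)
  also have "\<dots> \<le> ennreal (stage_cost i + (\<Sum>j=i..<i+Suc r. fail_bound \<mu> j * stage_cost (Suc j)))"
  proof (intro ennreal_leI add_left_mono)
    have "fail_bound \<mu> i * R \<le> R"
      using fb R by (simp add: mult_left_le_one_le)
    moreover have "(\<Sum>j=i..<i+Suc r. fail_bound \<mu> j * stage_cost (Suc j)) =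
        fail_bound \<mu> i * stage_cost (Suc i) + R"
      unfolding R_def by (subst sum.atLeast_Suc_lessThan) auto
    ultimately show "fail_bound \<mu> i * (stage_cost (Suc i) + R) \<le>
        (\<Sum>j=i..<i+Suc r. fail_bound \<mu> j * stage_cost (Suc j))"
      by (simp add: distrib_left)
  qed
  finally show ?case .
qed

lemma sum_stage_cost: "(\<Sum>j<r. stage_cost (Suc j) / 2 ^ j) \<le> 212"
proof -
  \<comment> \<open>The quadratic \<open>F\<close> is the solution of
    \<open>F r - F (r + 1) / 2 = stage_cost (r + 1)\<close>, so the sum telescopes to
    \<open>F 0 = 212\<close> minus a remainder.\<close>
  have "(\<Sum>j<r. stage_cost (Suc j) / 2 ^ j) =
      212 - (32 * (real r)\<^sup>2 + 136 * real r + 212) / 2 ^ r"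
  proof (induction r)
    case (Suc r)
    have "stage_cost (Suc r) / 2 ^ r =
        (32 * (real r)\<^sup>2 + 136 * real r + 212) / 2 ^ r -
        (32 * (real (Suc r))\<^sup>2 + 136 * real (Suc r) + 212) / 2 ^ Suc r"
      by (simp add: stage_cost_def power2_eq_square field_simps)
    then show ?case
      using Suc by simp
  qed simp
  then show ?thesis
    by simp
qed

text \<open>The constant is \<open>2 + 2 * 212\<close>, from stage 0 and the convergent series over
  later stages. Convergence makes the generous number \<open>q\<close> of stages harmless.\<close>

lemma expected_bits_trial_le:
  assumes "finite (A x)" "finite (B y)" "q > 0" "0 < \<mu>" "\<mu> \<le> 1"
    and card: "real (card (A x) + card (B y)) \<le> (1 - \<mu>) * real q"
  shows "(\<integral>\<^sup>+ xss. of_nat (bits (trial A B 0 xss) x y) \<partial>samples q 0 q) \<le> ennreal (426 / sqrt \<mu>)"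
proof -
  have "q \<le> 16 ^ (0 + q)"
    using less_exp[of q] power_mono[of 2 16 q] by simp
  then have "(\<integral>\<^sup>+ xss. of_nat (bits (trial A B 0 xss) x y) \<partial>samples q 0 q) \<le>
      ennreal (stage_cost 0 + (\<Sum>j=0..<0+q. fail_bound \<mu> j * stage_cost (Suc j)))"
    using assms by (intro expected_bits_trial)
  also have "\<dots> \<le> ennreal (426 / sqrt \<mu>)"
  proof (intro ennreal_leI)
    have "(\<Sum>j=0..<0+q. fail_bound \<mu> j * stage_cost (Suc j)) \<le>
        (\<Sum>j<q. 2 / (2 ^ j * sqrt \<mu>) * stage_cost (Suc j))"
      unfolding add_0 atLeast0LessThan
      by (intro sum_mono mult_right_mono) (auto simp: fail_bound_def stage_cost_def)
    also have "\<dots> = 2 / sqrt \<mu> * (\<Sum>j<q. stage_cost (Suc j) / 2 ^ j)"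
      by (simp add: sum_distrib_left field_simps)
    also have "\<dots> \<le> 2 / sqrt \<mu> * 212"
      using assms by (intro mult_left_mono sum_stage_cost) auto
    finally have "(\<Sum>j=0..<0+q. fail_bound \<mu> j * stage_cost (Suc j)) \<le> 424 / sqrt \<mu>"
      by simp
    moreover have "stage_cost 0 \<le> 2 / sqrt \<mu>"
      using assms by (simp add: stage_cost_def field_simps)
    moreover have "2 / sqrt \<mu> + 424 / sqrt \<mu> = 426 / sqrt \<mu>"
      by (simp flip: add_divide_distrib)
    ultimately show "stage_cost 0 + (\<Sum>j=0..<0+q. fail_bound \<mu> j * stage_cost (Suc j)) \<le> 426 / sqrt \<mu>"
      by linarith
  qed
  finally show ?thesis .
qed

section \<open>Ranks in a random order\<close>

definition before :: "'c list \<Rightarrow> 'c \<Rightarrow> 'c set" where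
  "before vs v = set (takeWhile (\<lambda>u. u \<noteq> v) vs)"

lemma before_Cons: "before (u # vs) v = (if u = v then {} else insert u (before vs v))"
  by (auto simp: before_def)

lemma before_append: "before (us @ vs) v = (if v \<in> set us then before us v else set us \<union> before vs v)"
  by (induction us) (auto simp: before_def)

lemma not_in_before [simp]: "v \<notin> before vs v"
  by (auto simp: before_def dest: set_takeWhileD)

lemma before_map: "inj f \<Longrightarrow> before (map f vs) (f v) = f ` before vs v"
  by (simp add: before_def takeWhile_map o_def inj_eq)

text \<open>Listed in the order of \<open>vs\<close>, the members of \<open>S\<close> have ranks
  \<open>0, 1, 2, ...\<close>, each exactly once.\<close>

lemma sum_card_before:
  fixes g :: "nat \<Rightarrow> real"
  assumes "distinct vs"
  shows "(\<Sum>v\<in>S \<inter> set vs. g (card (S \<inter> before vs v))) = (\<Sum>j<card (S \<inter> set vs). g j)"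
  using assms
proof (induction vs rule: rev_induct)
  case (snoc u vs)
  have "(\<Sum>v\<in>S \<inter> set vs. g (card (S \<inter> before (vs @ [u]) v))) = (\<Sum>v\<in>S \<inter> set vs. g (card (S \<inter> before vs v)))"
    by (intro sum.cong) (auto simp: before_append)
  then show ?case
    using snoc by (cases "u \<in> S") (simp_all add: before_append before_Cons)
qed simp

text \<open>Swapping \<open>v\<close> with a member of \<open>N\<close> permutes the orders, so the rank of \<open>v\<close> within
  \<open>insert v N\<close> is uniform.\<close>

lemma sum_rank_permutations:
  fixes g :: "nat \<Rightarrow> real"
  assumes "finite V" "N \<subseteq> V" "v \<in> V" "v \<notin> N"
  shows "(real (card N) + 1) * (\<Sum>vs\<in>permutations_of_set V. g (card (N \<inter> before vs v))) =
    fact (card V) * (\<Sum>j<card N + 1. g j)"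
proof -
  define S where "S = insert v N"
  have S: "S \<subseteq> V" "finite S" "card S = card N + 1" "v \<in> S"
    using assms finite_subset[of N V] by (auto simp: S_def)
  define h where "h w vs = g (card (S \<inter> before vs w))" for w vs
  have swap: "(\<Sum>vs\<in>permutations_of_set V. h w vs) = (\<Sum>vs\<in>permutations_of_set V. h v vs)" if "w \<in> S" for w
  proof -
    define f where "f = Transposition.transpose v w"
    have inj: "inj f" and f: "f v = w"
      by (auto simp: f_def)
    have fS: "f ` S = S" and fV: "f ` V = V"
      unfolding f_def using S that by (auto intro!: transpose_image_eq)
    have perms: "map f ` permutations_of_set V = permutations_of_set V"
      using permutations_of_set_image_inj[of f V] inj fV by (simp add: inj_on_subset)
    have "(\<Sum>vs\<in>permutations_of_set V. h w vs) = (\<Sum>vs\<in>map f ` permutations_of_set V. h w vs)"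
      by (simp add: perms)
    also have "\<dots> = (\<Sum>vs\<in>permutations_of_set V. h w (map f vs))"
      using inj by (subst sum.reindex) (auto intro: inj_on_subset[of _ UNIV])
    also have "\<dots> = (\<Sum>vs\<in>permutations_of_set V. h v vs)"
    proof (intro sum.cong refl)
      fix vs
      have "S \<inter> before (map f vs) w = f ` (S \<inter> before vs v)"
        using before_map[OF inj, of vs v] fS inj by (simp add: f image_Int)
      then show "h w (map f vs) = h v vs"
        using inj by (simp add: h_def card_image inj_on_subset[of _ UNIV])
    qed
    finally show ?thesis .
  qed
  \<comment> \<open>Double counting: by symmetry every \<open>w\<close> in \<open>S\<close>
    contributes the same total, and within one fixed order the ranks of \<open>S\<close> run through
    all values up to \<open>card N\<close>.\<close>
  have "(real (card N) + 1) * (\<Sum>vs\<in>permutations_of_set V. h v vs) =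
      (\<Sum>w\<in>S. \<Sum>vs\<in>permutations_of_set V. h w vs)"
  proof -
    have "(\<Sum>w\<in>S. \<Sum>vs\<in>permutations_of_set V. h w vs) = (\<Sum>w\<in>S. \<Sum>vs\<in>permutations_of_set V. h v vs)"
      by (rule sum.cong[OF refl swap])
    then show ?thesis
      using S(3) by simp
  qed
  also have "\<dots> = (\<Sum>vs\<in>permutations_of_set V. \<Sum>w\<in>S. h w vs)"
    by (rule sum.swap)
  also have "\<dots> = (\<Sum>vs\<in>permutations_of_set V. \<Sum>j<card N + 1. g j)"
  proof (intro sum.cong refl)
    fix vs assume "vs \<in> permutations_of_set V"
    then have "distinct vs" "S \<inter> set vs = S"
      using S by (auto dest: permutations_of_setD)
    then show "(\<Sum>w\<in>S. h w vs) = (\<Sum>j<card N + 1. g j)"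
      using sum_card_before[of vs g S] S by (simp add: h_def)
  qed
  also have "\<dots> = fact (card V) * (\<Sum>j<card N + 1. g j)"
    using assms by simp
  \<comment> \<open>As \<open>v\<close> never precedes itself, its rank in \<open>S\<close> equals
    its rank relative to \<open>N\<close>.\<close>
  finally show ?thesis
    by (simp add: h_def S_def Int_insert_left)
qed

section \<open>Averages of inverse square roots\<close>

lemma sum_inverse_sqrt:
  assumes "k \<le> q"
  shows "(\<Sum>j<k. 1 / sqrt (real q - real j)) \<le> 2 * (sqrt (real q) - sqrt (real q - real k))"
  using assms
proof (induction k)
  case (Suc k)
  define a where "a = real q - real k"
  have a: "a \<ge> 1"
    using Suc.prems by (simp add: a_def)
  \<comment> \<open>The term is at most twice a difference of consecutive square roots, so the sum
    telescopes like the integral of \<open>1 / sqrt a\<close>.\<close>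
  have "(sqrt a - sqrt (a - 1)) * (sqrt a + sqrt (a - 1)) = 1"
    using a by (simp add: algebra_simps)
  moreover have "(sqrt a - sqrt (a - 1)) * (sqrt a + sqrt (a - 1)) \<le> (sqrt a - sqrt (a - 1)) * (2 * sqrt a)"
    using a by (intro mult_left_mono) auto
  ultimately have "1 / sqrt a \<le> 2 * (sqrt a - sqrt (a - 1))"
    using a by (simp add: field_simps)
  moreover have "(\<Sum>j<k. 1 / sqrt (real q - real j)) \<le> 2 * (sqrt (real q) - sqrt a)"
    unfolding a_def using Suc by simp
  ultimately have "(\<Sum>j<Suc k. 1 / sqrt (real q - real j)) \<le>
      2 * (sqrt (real q) - sqrt a) + 2 * (sqrt a - sqrt (a - 1))"
    unfolding sum.lessThan_Suc a_def[symmetric] by (intro add_mono)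
  also have "\<dots> = 2 * (sqrt (real q) - sqrt (a - 1))"
    by (simp add: algebra_simps)
  also have "a - 1 = real q - real (Suc k)"
    by (simp add: a_def)
  finally show ?case .
qed simp

text \<open>The bound must be linear in \<open>k\<close> and not in \<open>q\<close>, so that
  vertices of low degree are cheap too; this follows from
  \<open>sqrt (q - k) \<le> sqrt q\<close>.\<close>

lemma average_inverse_sqrt:
  assumes "k \<le> q" "q > 0"
  shows "(\<Sum>j<k. sqrt (real q / (real q - real j))) \<le> 2 * real k"
proof -
  have "(real q - real k) * 1 = sqrt (real q - real k) * sqrt (real q - real k)"
    using assms by simp
  also have "\<dots> \<le> sqrt (real q) * sqrt (real q - real k)"
    using assms by (intro mult_right_mono) auto
  finally have "real q - sqrt (real q) * sqrt (real q - real k) \<le> real k"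
    by simp
  have "(\<Sum>j<k. sqrt (real q / (real q - real j))) = sqrt (real q) * (\<Sum>j<k. 1 / sqrt (real q - real j))"
    by (simp add: sum_distrib_left real_sqrt_divide)
  also have "\<dots> \<le> sqrt (real q) * (2 * (sqrt (real q) - sqrt (real q - real k)))"
    using assms by (intro mult_left_mono sum_inverse_sqrt) auto
  also have "\<dots> = 2 * (real q - sqrt (real q) * sqrt (real q - real k))"
    by (simp add: algebra_simps)
  also have "\<dots> \<le> 2 * real k"
    using \<open>real q - sqrt (real q) * sqrt (real q - real k) \<le> real k\<close> by simp
  finally show ?thesis .
qed

section \<open>Greedy colouring in random order\<close>

definition nbrs :: "edges \<Rightarrow> nat \<Rightarrow> nat set" where
  "nbrs E v = {u. {u, v} \<in> E}"

text \<open>The edge set comes last, so \<open>used U C v\<close> is a function of one player's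
  private input; \<open>U\<close>, \<open>C\<close> and \<open>v\<close> are known to both
  players.\<close>

definition used :: "nat set \<Rightarrow> (nat \<Rightarrow> nat) \<Rightarrow> nat \<Rightarrow> edges \<Rightarrow> nat set" where
  "used U C v E = C ` (nbrs E v \<inter> U)"

primrec colour ::
    "nat set \<Rightarrow> (nat \<Rightarrow> nat) \<Rightarrow> (nat \<times> nat list list) list \<Rightarrow> (edges, edges, nat \<Rightarrow> nat) protocol" where
  "colour U C [] = Output C"
| "colour U C (w # ws) = bindp (trial (used U C (fst w)) (used U C (fst w)) 0 (snd w))
     (\<lambda>c. colour (insert (fst w) U) (C(fst w := c)) ws)"

text \<open>The charge depends on the order alone and not on the colours chosen, which separates the
  randomness of the seeds from that of the order.\<close>

primrec order_cost :: "edges \<Rightarrow> (nat \<Rightarrow> real) \<Rightarrow> nat set \<Rightarrow> nat list \<Rightarrow> real" where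
  "order_cost E g U [] = 0"
| "order_cost E g U (v # vs) = g (card (nbrs E v \<inter> U)) + order_cost E g (insert v U) vs"

lemma order_cost_eq_sum:
  assumes "distinct vs"
  shows "order_cost E g U vs = (\<Sum>v\<in>set vs. g (card (nbrs E v \<inter> (U \<union> before vs v))))"
  using assms
proof (induction vs arbitrary: U)
  case (Cons u vs)
  have "(\<Sum>v\<in>set vs. g (card (nbrs E v \<inter> (insert u U \<union> before vs v)))) =
      (\<Sum>v\<in>set vs. g (card (nbrs E v \<inter> (U \<union> before (u # vs) v))))"
    using Cons.prems by (intro sum.cong) (auto simp: before_Cons)
  then show ?case
    using Cons by (simp add: before_Cons)
qed simp

definition greedy_protocol :: "nat \<Rightarrow> nat \<Rightarrow> (edges, edges, nat \<Rightarrow> nat) public_coin_protocol" where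
  "greedy_protocol n q = do {
     vs \<leftarrow> pmf_of_set (permutations_of_set {1..n});
     seeds \<leftarrow> replicate_pmf n (samples q 0 q);
     return_pmf (colour {} (\<lambda>_. undefined) (zip vs seeds))}"

locale edge_partition =
  fixes n \<Delta> q :: nat and EA EB :: edges
  assumes input: "edge_partition_input n \<Delta> EA EB" and q_def: "q = \<Delta> + 1"
begin

abbreviation "E \<equiv> EA \<union> EB"

text \<open>This is \<open>426 / sqrt \<mu>\<close> for the slack fraction
  \<open>\<mu> = (q - j) / q\<close> left by \<open>j\<close> coloured neighbours.\<close>

definition vertex_cost :: "nat \<Rightarrow> real" where
  "vertex_cost j = 426 * sqrt (real q / (real q - real j))"

section \<open>Neighbours and blocked colours\<close>

lemma q_pos: "q > 0"
  by (simp add: q_def)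

lemma edge: "e \<in> E \<Longrightarrow> e \<subseteq> {1..n} \<and> card e = 2"
  using input by (auto simp: edge_partition_input_def graph_on_def)

lemma finite_edges: "finite E"
  using edge by (intro finite_subset[of E "Pow {1..n}"]) auto

lemma nbrs_subset: "nbrs E v \<subseteq> {1..n}"
  using edge unfolding nbrs_def by blast

lemma not_in_nbrs: "v \<notin> nbrs E v"
  using edge[of "{v}"] by (auto simp: nbrs_def)

lemma finite_nbrs: "finite (nbrs E v)"
  using nbrs_subset finite_subset by blast

lemma card_nbrs:
  assumes "v \<in> {1..n}"
  shows "card (nbrs E v) < q"
proof -
  have "card (nbrs E v) = card ((\<lambda>u. {u, v}) ` nbrs E v)"
    by (intro card_image[symmetric] inj_onI) (auto simp: doubleton_eq_iff)
  also have "\<dots> \<le> degree E v"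
    unfolding degree_def using finite_edges by (intro card_mono) (auto simp: nbrs_def)
  also have "\<dots> \<le> max_degree n E"
    unfolding max_degree_def using assms by (intro Max_ge) auto
  finally show ?thesis
    using input by (simp add: q_def edge_partition_input_def)
qed

lemma finite_used: "finite (used U C v EA)" "finite (used U C v EB)"
  using finite_nbrs[of v] by (auto simp: used_def nbrs_def intro: rev_finite_subset)

lemma used_Un: "used U C v EA \<union> used U C v EB = used U C v E"
  by (auto simp: used_def nbrs_def)

text \<open>Disjointness of \<open>EA\<close> and \<open>EB\<close> enters here: no neighbour is
  counted on both sides, so even the sum of the two sizes is bounded.\<close>

lemma card_used: "card (used U C v EA) + card (used U C v EB) \<le> card (nbrs E v \<inter> U)"
proof -
  have fin: "finite (nbrs EA v \<inter> U)" "finite (nbrs EB v \<inter> U)"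
    using finite_nbrs[of v] by (auto simp: nbrs_def intro: rev_finite_subset)
  have "card (used U C v EA) + card (used U C v EB) \<le> card (nbrs EA v \<inter> U) + card (nbrs EB v \<inter> U)"
    unfolding used_def using fin by (intro add_mono card_image_le)
  also have "\<dots> = card ((nbrs EA v \<inter> U) \<union> (nbrs EB v \<inter> U))"
    using fin input by (intro card_Un_disjoint[symmetric]) (auto simp: nbrs_def edge_partition_input_def)
  also have "(nbrs EA v \<inter> U) \<union> (nbrs EB v \<inter> U) = nbrs E v \<inter> U"
    by (auto simp: nbrs_def)
  finally show ?thesis .
qed

lemma card_used_less:
  assumes "v \<in> {1..n}"
  shows "card (used U C v EA) + card (used U C v EB) < q"
proof -
  have "card (nbrs E v \<inter> U) \<le> card (nbrs E v)"
    using finite_nbrs by (intro card_mono) auto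
  then show ?thesis
    using card_used[of U C v] card_nbrs[OF assms] by linarith
qed

section \<open>Properness of the output\<close>

lemma run_trial_used:
  assumes "v \<in> {1..n}" "xss \<in> set_pmf (samples q 0 q)"
  shows "run (trial (used U C v) (used U C v) 0 xss) EA EB \<in> {1..q} - used U C v E"
proof -
  note xss = samplesD[OF assms(2) q_pos]
  have "last xss \<notin> covered (used U C v EA) (used U C v EB)"
    using xss card_used_less[OF assms(1), of U C] hits_distinct[of "[1..<Suc q]" "used U C v EA"]
      hits_distinct[of "[1..<Suc q]" "used U C v EB"] finite_used[of U C v]
    by (simp add: covered_def del: upt_Suc)
  \<comment> \<open>There are \<open>q + 1\<close> lists, so the palette is searched at stage
    \<open>q\<close>, where \<open>q < 2 ^ q \<le> 16 ^ q\<close>.\<close>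
  moreover have "length (last xss) \<le> 16 ^ (0 + length xss - 1)"
    using xss less_exp[of q] power_mono[of 2 16 q] by simp
  ultimately have "run (trial (used U C v) (used U C v) 0 xss) EA EB \<in>
      \<Union> (set ` set xss) - (used U C v EA \<union> used U C v EB)"
    using xss by (intro run_trial) auto
  then show ?thesis
    using xss used_Un by auto
qed

text \<open>Induction with the invariant that \<open>C\<close> is proper on the edges inside
  \<open>U\<close>; each new colour avoids those of the neighbours in \<open>U\<close>.\<close>

lemma run_colour:
  assumes "distinct vs" "set vs \<inter> U = {}" "U \<union> set vs = {1..n}" "length seeds = length vs"
    and "set seeds \<subseteq> set_pmf (samples q 0 q)"
    and "C \<in> U \<rightarrow>\<^sub>E {1..q}" "\<And>u v. u \<in> U \<Longrightarrow> v \<in> U \<Longrightarrow> {u, v} \<in> E \<Longrightarrow> C u \<noteq> C v"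
  shows "proper_coloring n q E (run (colour U C (zip vs seeds)) EA EB)"
  using assms
proof (induction vs arbitrary: U C seeds)
  case Nil
  have "{u, v} \<in> E \<Longrightarrow> u \<in> U \<and> v \<in> U" for u v
    using edge[of "{u, v}"] Nil by auto
  then show ?case
    using Nil by (auto simp: proper_coloring_def colorings_def)
next
  case (Cons v vs)
  obtain xss seeds' where seeds: "seeds = xss # seeds'"
    using Cons.prems by (cases seeds) auto
  define c where "c = run (trial (used U C v) (used U C v) 0 xss) EA EB"
  have "c \<in> {1..q} - used U C v E"
    unfolding c_def using Cons.prems(3,5) seeds by (intro run_trial_used) auto
  then have c: "c \<in> {1..q}" "c \<notin> used U C v E"
    by simp_all
  have v: "v \<notin> U" "{v, v} \<notin> E"
    using Cons.prems edge[of "{v}"] by auto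
  have "proper_coloring n q E (run (colour (insert v U) (C(v := c)) (zip vs seeds')) EA EB)"
  proof (intro Cons.IH)
    show "C(v := c) \<in> insert v U \<rightarrow>\<^sub>E {1..q}"
      using Cons.prems c by (intro PiE_fun_upd) auto
  next
    fix u w assume uw: "u \<in> insert v U" "w \<in> insert v U" "{u, w} \<in> E"
    then have "C u \<noteq> c" if "w = v" "u \<noteq> v"
      using that c by (auto simp: used_def nbrs_def)
    moreover from uw have "C w \<noteq> c" if "u = v" "w \<noteq> v"
      using that c by (auto simp: used_def nbrs_def insert_commute)
    ultimately show "(C(v := c)) u \<noteq> (C(v := c)) w"
      using uw v Cons.prems(7)[of u w] by (auto split: if_splits)
  qed (use Cons.prems seeds in auto)
  then show ?case
    by (simp add: seeds c_def)
qed

section \<open>Expected cost over seeds and orders\<close>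

lemma vertex_cost_nonneg: "j < q \<Longrightarrow> vertex_cost j \<ge> 0"
  by (simp add: vertex_cost_def)

lemma card_nbrs_Int: "v \<in> {1..n} \<Longrightarrow> card (nbrs E v \<inter> U) < q"
  using card_nbrs[of v] card_mono[OF finite_nbrs, of "nbrs E v \<inter> U" v] by auto

lemma order_cost_nonneg: "set vs \<subseteq> {1..n} \<Longrightarrow> order_cost E vertex_cost U vs \<ge> 0"
  by (induction vs arbitrary: U) (auto intro!: add_nonneg_nonneg vertex_cost_nonneg card_nbrs_Int)

lemma expected_bits_vertex:
  assumes "v \<in> {1..n}"
  shows "(\<integral>\<^sup>+ xss. of_nat (bits (trial (used U C v) (used U C v) 0 xss) EA EB) \<partial>samples q 0 q) \<le>
    ennreal (vertex_cost (card (nbrs E v \<inter> U)))"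
proof -
  define j where "j = card (nbrs E v \<inter> U)"
  define \<mu> where "\<mu> = (real q - real j) / real q"
  have j: "j < q"
    unfolding j_def using assms by (rule card_nbrs_Int)
  have "real (card (used U C v EA) + card (used U C v EB)) \<le> real j"
    unfolding j_def using card_used by (simp only: of_nat_le_iff)
  also have "\<dots> = (1 - \<mu>) * real q"
    using j by (simp add: \<mu>_def field_simps)
  finally have "(\<integral>\<^sup>+ xss. of_nat (bits (trial (used U C v) (used U C v) 0 xss) EA EB) \<partial>samples q 0 q) \<le>
      ennreal (426 / sqrt \<mu>)"
    using j by (intro expected_bits_trial_le finite_used q_pos) (auto simp: \<mu>_def)
  also have "426 / sqrt \<mu> = vertex_cost j"
    by (simp add: \<mu>_def vertex_cost_def real_sqrt_divide)
  finally show ?thesis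
    by (simp add: j_def)
qed

text \<open>The colour found for a vertex changes the later state, but the inductive bound is the
  same for every partial colouring, so the costs simply add up.\<close>

lemma expected_bits_colour:
  assumes "set vs \<subseteq> {1..n}"
  shows "(\<integral>\<^sup>+ seeds. of_nat (bits (colour U C (zip vs seeds)) EA EB)
      \<partial>replicate_pmf (length vs) (samples q 0 q)) \<le> ennreal (order_cost E vertex_cost U vs)"
  using assms
proof (induction vs arbitrary: U C)
  case (Cons v vs)
  define T where "T xss = trial (used U C v) (used U C v) 0 xss" for xss
  define K where "K xss = C(v := run (T xss) EA EB)" for xss
  define R where "R = order_cost E vertex_cost (insert v U) vs"
  have R: "R \<ge> 0"
    unfolding R_def using Cons.prems by (intro order_cost_nonneg) auto
  have "(\<integral>\<^sup>+ seeds. of_nat (bits (colour U C (zip (v # vs) seeds)) EA EB)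
      \<partial>replicate_pmf (length (v # vs)) (samples q 0 q)) =
    (\<integral>\<^sup>+ xss. \<integral>\<^sup>+ seeds. of_nat (bits (T xss) EA EB) +
        of_nat (bits (colour (insert v U) (K xss) (zip vs seeds)) EA EB)
      \<partial>replicate_pmf (length vs) (samples q 0 q) \<partial>samples q 0 q)"
    by (simp add: T_def K_def)
  also have "\<dots> = (\<integral>\<^sup>+ xss. of_nat (bits (T xss) EA EB) +
      (\<integral>\<^sup>+ seeds. of_nat (bits (colour (insert v U) (K xss) (zip vs seeds)) EA EB)
        \<partial>replicate_pmf (length vs) (samples q 0 q)) \<partial>samples q 0 q)"
    by (simp add: nn_integral_add)
  also have "\<dots> \<le> (\<integral>\<^sup>+ xss. of_nat (bits (T xss) EA EB) + ennreal R \<partial>samples q 0 q)"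
    unfolding R_def using Cons by (intro nn_integral_mono add_left_mono Cons.IH) auto
  also have "\<dots> = (\<integral>\<^sup>+ xss. of_nat (bits (T xss) EA EB) \<partial>samples q 0 q) + ennreal R"
    by (simp add: nn_integral_add)
  also have "\<dots> \<le> ennreal (vertex_cost (card (nbrs E v \<inter> U))) + ennreal R"
    unfolding T_def using Cons.prems by (intro add_right_mono expected_bits_vertex) auto
  also have "\<dots> = ennreal (order_cost E vertex_cost U (v # vs))"
    using R Cons.prems by (simp add: R_def vertex_cost_nonneg card_nbrs_Int)
  finally show ?case .
qed simp

text \<open>Linearity reduces the total to single vertices. The rank of a vertex of degree
  \<open>d\<close> among its neighbours is uniform on \<open>d + 1 \<le> q\<close> values, so its
  average cost is at most \<open>852 = 2 * 426\<close>; \<open>fact n\<close> counts the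
  orders.\<close>

lemma sum_order_cost:
  "(\<Sum>vs\<in>permutations_of_set {1..n}. order_cost E vertex_cost {} vs) \<le> fact n * (852 * real n)"
proof -
  have "(\<Sum>vs\<in>permutations_of_set {1..n}. order_cost E vertex_cost {} vs) =
      (\<Sum>vs\<in>permutations_of_set {1..n}. \<Sum>v=1..n. vertex_cost (card (nbrs E v \<inter> before vs v)))"
  proof (intro sum.cong refl)
    fix vs assume "vs \<in> permutations_of_set {1..n}"
    then have "distinct vs" "set vs = {1..n}"
      by (auto dest: permutations_of_setD)
    then show "order_cost E vertex_cost {} vs = (\<Sum>v=1..n. vertex_cost (card (nbrs E v \<inter> before vs v)))"
      by (simp add: order_cost_eq_sum)
  qed
  also have "\<dots> = (\<Sum>v=1..n. \<Sum>vs\<in>permutations_of_set {1..n}. vertex_cost (card (nbrs E v \<inter> before vs v)))"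
    by (rule sum.swap)
  also have "\<dots> \<le> (\<Sum>v=1..n. fact n * 852)"
  proof (intro sum_mono)
    fix v assume v: "v \<in> {1..n}"
    define d where "d = card (nbrs E v)"
    have "(\<Sum>j<d + 1. vertex_cost j) = 426 * (\<Sum>j<d + 1. sqrt (real q / (real q - real j)))"
      unfolding vertex_cost_def by (simp only: sum_distrib_left)
    also have "\<dots> \<le> 426 * (2 * real (d + 1))"
      using card_nbrs[OF v] by (intro mult_left_mono average_inverse_sqrt) (auto simp: d_def)
    finally have "(\<Sum>j<d + 1. vertex_cost j) \<le> 852 * (real d + 1)"
      by simp
    then have "fact n * (\<Sum>j<d + 1. vertex_cost j) \<le> fact n * (852 * (real d + 1))"
      by (intro mult_left_mono) auto
    then have "(real d + 1) * (\<Sum>vs\<in>permutations_of_set {1..n}. vertex_cost (card (nbrs E v \<inter> before vs v)))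
        \<le> (real d + 1) * (fact n * 852)"
      using sum_rank_permutations[of "{1..n}" "nbrs E v" v vertex_cost] v nbrs_subset not_in_nbrs
      by (simp add: d_def mult_ac)
    then show "(\<Sum>vs\<in>permutations_of_set {1..n}. vertex_cost (card (nbrs E v \<inter> before vs v))) \<le> fact n * 852"
      by (rule mult_left_le_imp_le) simp
  qed
  also have "\<dots> = fact n * (852 * real n)"
    by simp
  finally show ?thesis .
qed

lemma expected_bits_greedy: "expected_bits (greedy_protocol n q) EA EB \<le> ennreal (852 * real n)"
proof -
  define V where "V = permutations_of_set {1..n}"
  have V: "V \<noteq> {}" "finite V" "card V = fact n"
    by (auto simp: V_def)
  have vs: "set vs = {1..n}" "length vs = n" if "vs \<in> V" for vs
    using that by (auto simp: V_def permutations_of_setD length_finite_permutations_of_set)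
  have "expected_bits (greedy_protocol n q) EA EB =
      (\<integral>\<^sup>+ vs. \<integral>\<^sup>+ seeds. of_nat (bits (colour {} (\<lambda>_. undefined) (zip vs seeds)) EA EB)
        \<partial>replicate_pmf n (samples q 0 q) \<partial>pmf_of_set V)"
    by (simp add: expected_bits_def greedy_protocol_def V_def)
  also have "\<dots> \<le> (\<integral>\<^sup>+ vs. ennreal (order_cost E vertex_cost {} vs) \<partial>pmf_of_set V)"
  proof (intro nn_integral_mono_AE AE_pmfI)
    fix vs assume "vs \<in> set_pmf (pmf_of_set V)"
    then show "(\<integral>\<^sup>+ seeds. of_nat (bits (colour {} (\<lambda>_. undefined) (zip vs seeds)) EA EB)
        \<partial>replicate_pmf n (samples q 0 q)) \<le> ennreal (order_cost E vertex_cost {} vs)"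
      using expected_bits_colour[of vs] vs[of vs] V by simp
  qed
  also have "\<dots> = (\<Sum>vs\<in>V. ennreal (order_cost E vertex_cost {} vs)) / ennreal (fact n)"
    using V by (simp add: nn_integral_pmf_of_set ennreal_of_nat_eq_real_of_nat)
  also have "\<dots> = ennreal ((\<Sum>vs\<in>V. order_cost E vertex_cost {} vs) / fact n)"
    using vs by (simp add: sum_ennreal divide_ennreal sum_nonneg order_cost_nonneg)
  also have "\<dots> \<le> ennreal (852 * real n)"
    using sum_order_cost by (intro ennreal_leI) (simp add: V_def field_simps)
  finally show ?thesis .
qed

lemma proper_greedy:
  assumes "T \<in> set_pmf (greedy_protocol n q)"
  shows "proper_coloring n q E (run T EA EB)"
proof -
  obtain vs seeds where "vs \<in> permutations_of_set {1..n}"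
      and "seeds \<in> set_pmf (replicate_pmf n (samples q 0 q))"
      and T: "T = colour {} (\<lambda>_. undefined) (zip vs seeds)"
    using assms by (auto simp: greedy_protocol_def)
  then show ?thesis
    unfolding T
    by (intro run_colour)
      (auto simp: set_replicate_pmf permutations_of_setD length_finite_permutations_of_set lists_eq_set)
qed

end

theorem theorem1p1:
  "\<exists>(P :: nat \<Rightarrow> nat \<Rightarrow> (edges, edges, nat \<Rightarrow> nat) public_coin_protocol) (c :: real).
     \<forall>n \<Delta>. n \<ge> 1 \<longrightarrow>
       zero_error_coloring n \<Delta> (\<Delta> + 1) (P n \<Delta>) \<and>
       (\<forall>EA EB. edge_partition_input n \<Delta> EA EB \<longrightarrow>
          expected_bits (P n \<Delta>) EA EB \<le> ennreal (c * real n))"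
proof (intro exI allI impI conjI)
  fix n \<Delta> :: nat
  \<comment> \<open>The witnesses are
    \<open>\<lambda>n \<Delta>. greedy_protocol n (\<Delta> + 1)\<close> and \<open>852\<close>,
    fixed by unification with the two goals.\<close>
  show "zero_error_coloring n \<Delta> (\<Delta> + 1) (greedy_protocol n (\<Delta> + 1))"
    unfolding zero_error_coloring_def
  proof (intro allI impI ballI)
    fix EA EB T
    assume "edge_partition_input n \<Delta> EA EB" and T: "T \<in> set_pmf (greedy_protocol n (\<Delta> + 1))"
    then interpret edge_partition n \<Delta> "\<Delta> + 1" EA EB
      by unfold_locales auto
    show "proper_coloring n (\<Delta> + 1) (EA \<union> EB) (run T EA EB)"
      using T by (rule proper_greedy)
  qed
next
  fix n \<Delta> EA EB
  assume "edge_partition_input n \<Delta> EA EB"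
  then interpret edge_partition n \<Delta> "\<Delta> + 1" EA EB
    by unfold_locales auto
  show "expected_bits (greedy_protocol n (\<Delta> + 1)) EA EB \<le> ennreal (852 * real n)"
    by (rule expected_bits_greedy)
qed

end
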